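(* Let $N\ge1$ be an integer and let $\alpha,\beta\in\mathbb C$ with $\alpha\notin\{0,-1,\dots,-(N-1)\}$ and $\beta\notin\{-1,-2,\dots,-N\}$. For $0\le n\le N$ define the rational function $$U_n(x)=\frac{(-1)^n}{(\alpha-x)_n}\,\frac{(\alpha)_n(-N)_n}{(\beta+1)_n}\;{}_3F_2\!\left({-n,\;-x,\;-\beta-n\atop -N,\;1-\alpha-n};1\right).$$ Define the difference operators $$L_1=(x-\alpha+1)(x-\alpha)(x-N)T^{+}+x(x-\alpha)(x+\beta-\alpha-N)T^{-}+(x-\alpha)\bigl(-2x^2+(2\alpha-1+2N-\beta)x-N(\alpha-1)\bigr)\mathcal I,$$ $$L_2=(x-\alpha)\mathcal I-xT^{-}.$$ Then $U_n$ satisfies the generalized eigenvalue problem $$L_1U_n=\lambda_nL_2U_n,\qquad \lambda_n=n(N-\beta-n),\qquad n=0,1,\dots,N,$$ and both $L_1$ and $L_2$ are Heun-Hahn operators; for $L_2$ the parameters are $\kappa=\mu_1=\mu_0=\nu_1=r_1=0$, $\nu_0=-1$, $r_0=-\alpha$.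
   Context: $T^{\pm}f(x)=f(x\pm1)$, $\mathcal I$ is the identity, $(a)_n=a(a+1)\cdots(a+n-1)$, and the terminating ${}_3F_2$ series is summed over $k=0,\dots,n$. The difference equation is an identity of rational functions in $x$. A Heun-Hahn operator is an operator $A_1(x)T^{+}+A_2(x)T^{-}+A_0(x)\mathcal I$ with $$A_1(x)=(x-N)(\kappa x^2+\mu_1x+\mu_0),\quad A_2(x)=x(\kappa x^2+\nu_1x+\nu_0),\quad A_0(x)=-A_1(x)-A_2(x)+r_1x+r_0$$ for some constants $\kappa,\mu_0,\mu_1,\nu_0,\nu_1,r_0,r_1\in\mathbb C$. *)

theory Defs
  imports
    Complex_Main
    "HOL-Computational_Algebra.Polynomial_Factorial"
begin

text \<open>Rational functions in one indeterminate over the complex numbers are the elements of the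
  fraction field of the polynomial ring.\<close>

type_synonym ratfun = "complex poly fract"

definition rC :: "complex \<Rightarrow> ratfun" where
  "rC c = to_fract [:c:]"

definition rX :: ratfun where
  "rX = to_fract [:0, 1:]"

text \<open>The substitution \<open>f(x) \<mapsto> f(x + c)\<close>, acting on numerator and denominator
  (independent of the chosen fraction by the lemma below).\<close>

definition shift :: "complex \<Rightarrow> ratfun \<Rightarrow> ratfun" where
  "shift c f = (THE g. \<exists>p q. q \<noteq> 0 \<and> f = Fract p q \<and>
     g = Fract (pcompose p [:c, 1:]) (pcompose q [:c, 1:]))"

lemma shift_Fract:
  assumes "q \<noteq> 0"
  shows "shift c (Fract p q) = Fract (pcompose p [:c, 1:]) (pcompose q [:c, 1:])"
  unfolding shift_def
proof (rule the_equality)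
  fix g assume "\<exists>r s. s \<noteq> 0 \<and> Fract p q = Fract r s \<and>
    g = Fract (pcompose r [:c, 1:]) (pcompose s [:c, 1:])"
  then obtain r s where s: "s \<noteq> 0" and eq: "Fract p q = Fract r s"
    and g: "g = Fract (pcompose r [:c, 1:]) (pcompose s [:c, 1:])"
    by blast
  have nz: "pcompose q [:c, 1:] \<noteq> 0" "pcompose s [:c, 1:] \<noteq> 0"
    using assms s pcompose_eq_0[of _ "[:c, 1:]"] by auto
  have "p * s = r * q"
    using eq assms s by (simp add: eq_fract)
  then have "pcompose p [:c, 1:] * pcompose s [:c, 1:] =
        pcompose r [:c, 1:] * pcompose q [:c, 1:]"
    by (metis pcompose_mult)
  with nz show "g = Fract (pcompose p [:c, 1:]) (pcompose q [:c, 1:])"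
    unfolding g by (simp add: eq_fract)
qed (use assms in blast)

definition Tplus :: "ratfun \<Rightarrow> ratfun" where
  "Tplus = shift 1"

definition Tminus :: "ratfun \<Rightarrow> ratfun" where
  "Tminus = shift (- 1)"

definition diff_op :: "ratfun \<Rightarrow> ratfun \<Rightarrow> ratfun \<Rightarrow> ratfun \<Rightarrow> ratfun" where
  "diff_op A1 A2 A0 f = A1 * Tplus f + A2 * Tminus f + A0 * f"

definition heun_hahn_op ::
  "nat \<Rightarrow> complex \<Rightarrow> complex \<Rightarrow> complex \<Rightarrow> complex \<Rightarrow> complex \<Rightarrow> complex \<Rightarrow> complex \<Rightarrow> ratfun \<Rightarrow> ratfun" where
  "heun_hahn_op N \<kappa> \<mu>1 \<mu>0 \<nu>1 \<nu>0 r1 r0 =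
     (let A1 = (rX - of_nat N) * (rC \<kappa> * rX ^ 2 + rC \<mu>1 * rX + rC \<mu>0);
          A2 = rX * (rC \<kappa> * rX ^ 2 + rC \<nu>1 * rX + rC \<nu>0);
          A0 = - A1 - A2 + rC r1 * rX + rC r0
      in diff_op A1 A2 A0)"

definition is_heun_hahn :: "nat \<Rightarrow> (ratfun \<Rightarrow> ratfun) \<Rightarrow> bool" where
  "is_heun_hahn N L \<longleftrightarrow>
     (\<exists>\<kappa> \<mu>1 \<mu>0 \<nu>1 \<nu>0 r1 r0. L = heun_hahn_op N \<kappa> \<mu>1 \<mu>0 \<nu>1 \<nu>0 r1 r0)"

text \<open>The \<open>\<^sub>3F\<^sub>2\<close> series with upper parameters \<open>a\<close>, \<open>b\<close>, \<open>c\<close> and lower parameters \<open>d\<close>, \<open>e\<close>,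
  summed over \<open>k = 0, \<dots>, n\<close>.\<close>

definition hyp3F2_upto :: "nat \<Rightarrow> 'a \<Rightarrow> 'a \<Rightarrow> 'a \<Rightarrow> 'a \<Rightarrow> 'a \<Rightarrow> 'a \<Rightarrow> 'a::field" where
  "hyp3F2_upto n a b c d e z =
     (\<Sum>k = 0..n. pochhammer a k * pochhammer b k * pochhammer c k /
        (pochhammer d k * pochhammer e k * of_nat (fact k)) * z ^ k)"

definition U :: "nat \<Rightarrow> complex \<Rightarrow> complex \<Rightarrow> nat \<Rightarrow> ratfun" where
  "U N \<alpha> \<beta> n =
     (- 1) ^ n / pochhammer (rC \<alpha> - rX) n *
     rC (pochhammer \<alpha> n * pochhammer (- of_nat N) n / pochhammer (\<beta> + 1) n) *
     hyp3F2_upto n (- of_nat n) (- rX) (rC (- \<beta> - of_nat n))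
       (- of_nat N) (rC (1 - \<alpha> - of_nat n)) 1"

definition L1 :: "nat \<Rightarrow> complex \<Rightarrow> complex \<Rightarrow> ratfun \<Rightarrow> ratfun" where
  "L1 N \<alpha> \<beta> = diff_op
     ((rX - rC \<alpha> + 1) * (rX - rC \<alpha>) * (rX - of_nat N))
     (rX * (rX - rC \<alpha>) * (rX + rC \<beta> - rC \<alpha> - of_nat N))
     ((rX - rC \<alpha>) * (- 2 * rX ^ 2 + rC (2 * \<alpha> - 1 + 2 * of_nat N - \<beta>) * rX
        - rC (of_nat N * (\<alpha> - 1))))"

definition L2 :: "complex \<Rightarrow> ratfun \<Rightarrow> ratfun" where
  "L2 \<alpha> = diff_op 0 (- rX) (rX - rC \<alpha>)"

definition eigval :: "nat \<Rightarrow> complex \<Rightarrow> nat \<Rightarrow> complex" where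
  "eigval N \<beta> n = of_nat n * (of_nat N - \<beta> - of_nat n)"

end

theory Submission
  imports Defs
begin

text \<open>
  Writing \<open>U\<^sub>n = C F / (\<alpha> - x)\<^sub>n\<close> with a constant \<open>C\<close>, the factor \<open>F\<close> is a Hahn polynomial
  with parameters \<open>- \<alpha> - n\<close> and \<open>\<alpha> - \<beta> - n - 1\<close>, which depend on \<open>n\<close>.  After cancelling
  \<open>(\<alpha> - x)\<^sub>n\<close>, the generalized eigenvalue problem becomes the Hahn difference equation, because with
  \<open>y = x - \<alpha>\<close> the total coefficient of \<open>T\<^sup>- U\<^sub>n\<close> in \<open>L\<^sub>1 U\<^sub>n - \<lambda>\<^sub>n L\<^sub>2 U\<^sub>n\<close> factorizes as
  \<open>x (y (y + \<beta> - N) + \<lambda>\<^sub>n) = x (y - n) (y + n + \<beta> - N)\<close> and \<open>y - n\<close> cancels.  The Hahn equation itself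
  follows since its operator is bidiagonal in the basis \<open>(- x)\<^sub>k\<close>, so that the series telescopes.
\<close>

section \<open>Hahn difference equation over a field of characteristic zero\<close>

instance fract :: ("{idom, ring_char_0}") ring_char_0
  by standard (simp add: inj_on_def of_nat_fract eq_fract)

text \<open>The series lemmas are stated for any \<open>field_char_0\<close>, so that the
  indeterminate \<open>rX\<close> itself can later be substituted for \<open>x\<close>.\<close>

instance fract :: ("{idom, ring_char_0}") field_char_0 ..

text \<open>The operator sends (-x)_k to (k-n)(k+c)(-x)_k - k(d+k-1)(e+k-1)(-x)_{k-1}. By the ratio
  of consecutive \<open>p\<close>, the second part cancels the first part of the preceding summand,
  so only the first part at k = m survives.\<close>

lemma hyp3F2_partial_sum_difference:
  fixes x c d e :: "'a::field_char_0" and n :: nat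
  defines "p \<equiv> \<lambda>k. pochhammer (- of_nat n) k * pochhammer c k /
                   (pochhammer d k * pochhammer e k * of_nat (fact k))"
  assumes "pochhammer d n \<noteq> 0" "pochhammer e n \<noteq> 0" "m \<le> n"
  shows "(\<Sum>k\<le>m. p k *
      ((x + d) * (x + e) * (pochhammer (- (x + 1)) k - pochhammer (- x) k)
      + x * (x - c + of_nat n + e + d - 1) * (pochhammer (- (x - 1)) k - pochhammer (- x) k)
      - of_nat n * c * pochhammer (- x) k))
    = p m * (of_nat m - of_nat n) * (of_nat m + c) * pochhammer (- x) m"
  using \<open>m \<le> n\<close>
proof (induction m)
  case 0
  show ?case by (simp add: p_def)
next
  case (Suc m)
  define \<phi> where "\<phi> = pochhammer (- x) m"
  define M where "M = (of_nat m :: 'a)"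
  have down: "pochhammer (- (x + 1)) (Suc m) = (- x - 1) * \<phi>"
    by (simp add: pochhammer_rec \<phi>_def)
  have same: "pochhammer (- x) (Suc m) = \<phi> * (M - x)"
    by (simp add: pochhammer_Suc \<phi>_def M_def)
  have "- x * pochhammer (1 - x) (Suc m) = pochhammer (- x) (Suc (Suc m))"
    by (simp add: pochhammer_rec[of "- x" "Suc m"])
  also have "\<dots> = \<phi> * (M - x) * (M + 1 - x)"
    unfolding pochhammer_Suc[of "- x" "Suc m"] same by (simp add: M_def algebra_simps)
  finally have up: "x * pochhammer (- (x - 1)) (Suc m) = \<phi> * (M - x) * (x - M - 1)"
    by (simp add: algebra_simps)
  have nz: "d + M \<noteq> 0" "e + M \<noteq> 0" "M + 1 \<noteq> 0" "pochhammer d m \<noteq> 0" "pochhammer e m \<noteq> 0"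
    using pochhammer_neq_0_mono[OF assms(2) Suc.prems] pochhammer_neq_0_mono[OF assms(3) Suc.prems]
    by (auto simp: pochhammer_Suc M_def of_nat_Suc[symmetric] add.commute
        simp del: of_nat_Suc)
  have p_Suc: "p (Suc m) * ((M + 1) * (d + M) * (e + M)) = p m * (M - of_nat n) * (M + c)"
    using nz by (simp add: p_def pochhammer_Suc M_def[symmetric] divide_simps)
      (simp add: algebra_simps)
  let ?D = "x - c + of_nat n + e + d - 1"
  have "(x + d) * (x + e) * (pochhammer (- (x + 1)) (Suc m) - pochhammer (- x) (Suc m))
      + x * ?D * (pochhammer (- (x - 1)) (Suc m) - pochhammer (- x) (Suc m))
      - of_nat n * c * pochhammer (- x) (Suc m)
    = (x + d) * (x + e) * ((- x - 1) * \<phi> - \<phi> * (M - x))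
      + ?D * (\<phi> * (M - x) * (x - M - 1) - x * (\<phi> * (M - x))) - of_nat n * c * (\<phi> * (M - x))"
    unfolding down same up[symmetric] by (simp add: algebra_simps)
  \<comment> \<open>Here \<phi> * (M - x) and \<phi> are the two neighbouring basis elements
    (-x)_{m+1} and (-x)_m.\<close>
  also have "\<dots> = (M + 1 - of_nat n) * (M + 1 + c) * (\<phi> * (M - x))
      - (M + 1) * (d + M) * (e + M) * \<phi>"
    by (simp add: algebra_simps)
  finally have term_eq: "(x + d) * (x + e) * (pochhammer (- (x + 1)) (Suc m) - pochhammer (- x) (Suc m))
      + x * ?D * (pochhammer (- (x - 1)) (Suc m) - pochhammer (- x) (Suc m))
      - of_nat n * c * pochhammer (- x) (Suc m)
    = (M + 1 - of_nat n) * (M + 1 + c) * (\<phi> * (M - x)) - (M + 1) * (d + M) * (e + M) * \<phi>" .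
  have "p m * (M - of_nat n) * (M + c) * \<phi>
      + p (Suc m) * ((M + 1 - of_nat n) * (M + 1 + c) * (\<phi> * (M - x)) - (M + 1) * (d + M) * (e + M) * \<phi>)
    = p (Suc m) * (M + 1 - of_nat n) * (M + 1 + c) * (\<phi> * (M - x))"
    unfolding p_Suc[symmetric] by (simp only: algebra_simps)
  then show ?case
    unfolding sum.atMost_Suc Suc.IH[OF Suc_leD[OF Suc.prems]] term_eq unfolding same
    by (simp only: M_def[symmetric] \<phi>_def[symmetric] of_nat_Suc add.commute[of 1])
qed

text \<open>For \<open>d\<close> = -N, \<open>e\<close> = a+1 and \<open>c\<close> = n+a+b+1 this is
  the classical equation of the Hahn polynomial with parameters a, b.\<close>

lemma hyp3F2_hahn_difference_equation:
  fixes x c d e :: "'a::field_char_0" and n :: nat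
  defines "F \<equiv> \<lambda>y. hyp3F2_upto n (- of_nat n) (- y) c d e 1"
  assumes "pochhammer d n \<noteq> 0" "pochhammer e n \<noteq> 0"
  shows "(x + d) * (x + e) * (F (x + 1) - F x)
    + x * (x - c + of_nat n + e + d - 1) * (F (x - 1) - F x) = of_nat n * c * F x"
proof -
  define p where "p = (\<lambda>k. pochhammer (- of_nat n) k * pochhammer c k /
                   (pochhammer d k * pochhammer e k * (of_nat (fact k) :: 'a)))"
  have F: "F y = (\<Sum>k\<le>n. p k * pochhammer (- y) k)" for y
    unfolding F_def hyp3F2_upto_def p_def atMost_atLeast0
    by (intro sum.cong) auto
  have "(x + d) * (x + e) * (F (x + 1) - F x)
      + x * (x - c + of_nat n + e + d - 1) * (F (x - 1) - F x) - of_nat n * c * F x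
    = (\<Sum>k\<le>n. p k *
      ((x + d) * (x + e) * (pochhammer (- (x + 1)) k - pochhammer (- x) k)
      + x * (x - c + of_nat n + e + d - 1) * (pochhammer (- (x - 1)) k - pochhammer (- x) k)
      - of_nat n * c * pochhammer (- x) k))"
    unfolding F sum_distrib_left sum_subtractf[symmetric] sum.distrib[symmetric]
    by (intro sum.cong refl) (simp only: algebra_simps)
  \<comment> \<open>At m = n the surviving term contains the factor n - n.\<close>
  also have "\<dots> = 0"
    using hyp3F2_partial_sum_difference[OF assms(2,3) order.refl, of c x] by (simp add: p_def)
  finally show ?thesis by simp
qed

section \<open>Constants and shifts as field homomorphisms\<close>

lemma rC_simps [simp]:
  "rC 0 = 0" "rC 1 = 1" "rC (a + b) = rC a + rC b" "rC (a - b) = rC a - rC b"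
  "rC (- a) = - rC a" "rC (a * b) = rC a * rC b" "rC (of_nat k) = of_nat k"
proof -
  show add: "rC (a + b) = rC a + rC b" for a b
    by (simp add: rC_def flip: to_fract_add)
  show zero: "rC 0 = 0" and one: "rC 1 = 1"
    by (simp_all add: rC_def flip: one_pCons)
  show "rC (of_nat k) = of_nat k"
    by (induction k) (simp_all add: add zero one)
qed (simp_all add: rC_def flip: to_fract_diff to_fract_uminus to_fract_mult)

lemma rC_numeral [simp]: "rC (numeral k) = numeral k"
  using rC_simps(7)[of "numeral k"] by simp

lemma rC_eq_0_iff [simp]: "rC a = 0 \<longleftrightarrow> a = 0"
  by (simp add: rC_def)

lemma rC_pochhammer: "rC (pochhammer a k) = pochhammer (rC a) k"
  by (induction k) (simp_all add: pochhammer_Suc)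

lemma rC_diff_rX_neq_0: "rC a - rX \<noteq> 0"
  by (simp add: rC_def rX_def flip: to_fract_diff)

lemma shift_to_fract: "shift c (to_fract p) = to_fract (pcompose p [:c, 1:])"
  by (simp add: to_fract_def shift_Fract pcompose_1)

lemma shift_rC [simp]: "shift c (rC a) = rC a"
  by (simp add: rC_def shift_to_fract)

lemma shift_rX [simp]: "shift c rX = rX + rC c"
  by (simp add: rC_def rX_def shift_to_fract pcompose_pCons flip: to_fract_add)

lemma pcompose_linear_neq_0: "q \<noteq> 0 \<Longrightarrow> pcompose q [:c, 1:] \<noteq> (0 :: complex poly)"
  using pcompose_eq_0[of q "[:c, 1:]"] by auto

lemma shift_0 [simp]: "shift c 0 = 0" and shift_1 [simp]: "shift c 1 = 1"
  using shift_rC[of c 0] shift_rC[of c 1] by simp_all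

lemma shift_add [simp]: "shift c (f + g) = shift c f + shift c g"
  by (cases f; cases g)
    (simp add: shift_Fract pcompose_linear_neq_0 pcompose_add pcompose_mult)

lemma shift_mult [simp]: "shift c (f * g) = shift c f * shift c g"
  by (cases f; cases g) (simp add: shift_Fract pcompose_mult)

lemma shift_uminus [simp]: "shift c (- f) = - shift c f"
  by (cases f) (simp add: shift_Fract pcompose_uminus)

lemma shift_diff [simp]: "shift c (f - g) = shift c f - shift c g"
  using shift_add[of c f "- g"] by simp

lemma shift_inverse [simp]: "shift c (inverse f) = inverse (shift c f)"
\<comment> \<open>A unit is sent to a unit by multiplicativity; f = 0 rests on the convention
  \<open>inverse 0 = 0\<close>.\<close>
proof (cases "f = 0")
  case False
  then have "shift c f * shift c (inverse f) = 1"
    by (simp flip: shift_mult)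
  then show ?thesis by (rule inverse_unique[symmetric])
qed simp

lemma shift_divide [simp]: "shift c (f / g) = shift c f / shift c g"
  by (simp add: divide_inverse)

lemma shift_power [simp]: "shift c (f ^ k) = shift c f ^ k"
  by (induction k) simp_all

lemma shift_of_nat [simp]: "shift c (of_nat k) = of_nat k"
  by (induction k) simp_all

lemma shift_fact [simp]: "shift c (fact k) = fact k"
  using shift_of_nat[of c "fact k"] by simp

lemma shift_sum [simp]: "shift c (sum f A) = (\<Sum>a\<in>A. shift c (f a))"
  by (induction A rule: infinite_finite_induct) simp_all

lemma shift_pochhammer [simp]: "shift c (pochhammer f k) = pochhammer (shift c f) k"
  by (induction k) (simp_all add: pochhammer_Suc)

lemma shift_hyp3F2_upto [simp]:
  "shift s (hyp3F2_upto n a b c d e z) =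
     hyp3F2_upto n (shift s a) (shift s b) (shift s c) (shift s d) (shift s e) (shift s z)"
  by (simp add: hyp3F2_upto_def)

text \<open>Each factor is a nonconstant polynomial in the indeterminate, whatever the constant
  \<open>a\<close>. This covers the denominator of \<open>U\<close> and of both its shifts.\<close>

lemma pochhammer_rC_diff_rX_neq_0: "pochhammer (rC a - rX) k \<noteq> 0"
proof (induction k)
  case (Suc k)
  then show ?case
    using rC_diff_rX_neq_0[of "a + of_nat k"] by (simp add: pochhammer_Suc add_diff_eq diff_add_eq)
qed simp

section \<open>Heun-Hahn form and the generalized eigenvalue problem\<close>

lemma L1_eq_heun_hahn_op:
  "L1 N \<alpha> \<beta> = heun_hahn_op N 1 (1 - 2 * \<alpha>) (\<alpha> * (\<alpha> - 1))
     (\<beta> - 2 * \<alpha> - of_nat N) (- \<alpha> * (\<beta> - \<alpha> - of_nat N)) 0 0"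
  \<comment> \<open>The zeros for \<open>r1\<close> and \<open>r0\<close> mean that
    \<open>L1\<close> annihilates constants, in accordance with U_0 = 1 and eigenvalue 0.\<close>
  unfolding L1_def heun_hahn_op_def Let_def
  by (intro arg_cong3[where f = diff_op]; simp add: algebra_simps power2_eq_square)

lemma L2_eq_heun_hahn_op: "L2 \<alpha> = heun_hahn_op N 0 0 0 0 (- 1) 0 (- \<alpha>)"
  by (simp add: L2_def heun_hahn_op_def)

lemma L1_U_eq_eigval_L2_U:
  assumes "pochhammer (1 - \<alpha> - of_nat n) n \<noteq> 0" "n \<le> N"
  shows "L1 N \<alpha> \<beta> (U N \<alpha> \<beta> n) = rC (eigval N \<beta> n) * L2 \<alpha> (U N \<alpha> \<beta> n)"
proof -
  define X Y a b M n' where "X = rX" and "Y = rC \<alpha> - rX" and "a = rC \<alpha>" and "b = rC \<beta>"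
    and "M = (of_nat N :: ratfun)" and "n' = (of_nat n :: ratfun)"
  define c e where "c = - b - n'" and "e = 1 - a - n'"
  define F where "F = (\<lambda>y. hyp3F2_upto n (- of_nat n) (- y) c (- M) e 1)"
  define P where "P = pochhammer Y n"
  \<comment> \<open>\<kappa> contains 1/P and so depends on x; \<kappa> * P is the constant that
    both shifts fix.\<close>
  define \<kappa> where "\<kappa> = (- 1) ^ n / P *
    rC (pochhammer \<alpha> n * pochhammer (- of_nat N) n / pochhammer (\<beta> + 1) n)"
  have Y: "Y = a - X" and X: "X = a - Y"
    by (simp_all add: Y_def a_def X_def)
  have P_nz: "P \<noteq> 0" "pochhammer (Y - 1) n \<noteq> 0" "pochhammer (Y + 1) n \<noteq> 0"
    using pochhammer_rC_diff_rX_neq_0[of \<alpha> n] pochhammer_rC_diff_rX_neq_0[of "\<alpha> - 1" n]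
      pochhammer_rC_diff_rX_neq_0[of "\<alpha> + 1" n]
    by (simp_all add: Y_def P_def algebra_simps)
  \<comment> \<open>T+ turns Y into Y - 1 and T- turns it into Y + 1. Consecutive Pochhammer
    products share all but one factor each, so a single linear factor clears each quotient.\<close>
  have P_down: "(Y - 1) * P / pochhammer (Y - 1) n = Y - 1 + n'"
    using pochhammer_rec[of "Y - 1" n] P_nz(2)
    by (simp add: pochhammer_Suc P_def n'_def nonzero_divide_eq_eq mult.commute)
  have P_up: "(Y + n') * P / pochhammer (Y + 1) n = Y"
    using pochhammer_rec[of Y n] P_nz(3)
    by (simp add: pochhammer_Suc P_def n'_def nonzero_divide_eq_eq mult.commute)
  have U: "U N \<alpha> \<beta> n = \<kappa> * F X"
    by (simp add: U_def \<kappa>_def F_def P_def Y_def X_def M_def c_def e_def a_def b_def n'_def)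
  have "Tplus (U N \<alpha> \<beta> n) = \<kappa> * P / pochhammer (Y - 1) n * F (X + 1)"
    using P_nz(1) by (simp add: U_def Tplus_def \<kappa>_def F_def Y_def X_def M_def c_def e_def a_def
        b_def n'_def algebra_simps)
  then have U_plus: "(Y - 1) * Tplus (U N \<alpha> \<beta> n) = (Y - 1 + n') * \<kappa> * F (X + 1)"
    unfolding P_down[symmetric] by simp
  have "Tminus (U N \<alpha> \<beta> n) = \<kappa> * P / pochhammer (Y + 1) n * F (X - 1)"
    using P_nz(1) by (simp add: U_def Tminus_def \<kappa>_def F_def Y_def X_def M_def c_def e_def a_def
        b_def n'_def algebra_simps)
  then have U_minus: "(Y + n') * Tminus (U N \<alpha> \<beta> n) =
      ((Y + n') * P / pochhammer (Y + 1) n) * \<kappa> * F (X - 1)"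
    by simp
  have "pochhammer (- M) n \<noteq> 0"
    using assms(2) by (simp add: M_def pochhammer_of_nat_eq_0_iff)
  moreover have "pochhammer e n \<noteq> 0"
    using assms(1) by (simp add: e_def a_def n'_def flip: rC_eq_0_iff) (simp add: rC_pochhammer)
  ultimately have "(X - M) * (X + e) * (F (X + 1) - F X)
      + X * (X - c + n' + e - M - 1) * (F (X - 1) - F X) = n' * c * F X"
    using hyp3F2_hahn_difference_equation[of "- M" n e X c] by (simp add: F_def n'_def)
  \<comment> \<open>Uses X + e = -(Y - 1 + n') and X - c + n' + e - M - 1 = b + n' - M - Y.\<close>
  then have hahn: "- (X - M) * (Y - 1 + n') * (F (X + 1) - F X)
      + X * (b + n' - M - Y) * (F (X - 1) - F X) = n' * (- b - n') * F X"
    unfolding Y c_def e_def by (simp add: algebra_simps)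
  define V Vp Vm where "V = U N \<alpha> \<beta> n" and "Vp = Tplus V" and "Vm = Tminus V"
  \<comment> \<open>The T- terms of \<open>L1\<close> and \<open>L2\<close> are merged: Y(b - M - Y)
    - n'(M - b - n') = (Y + n')(b + n' - M - Y). The factors Y - 1 and Y + n' are kept next to
    \<open>Vp\<close> and \<open>Vm\<close> for \<open>U_plus\<close> and
    \<open>U_minus\<close>.\<close>
  have "L1 N \<alpha> \<beta> V - rC (eigval N \<beta> n) * L2 \<alpha> V
    = Y * (X - M) * ((Y - 1) * Vp) - X * (b + n' - M - Y) * ((Y + n') * Vm)
      - Y * ((- 2 * X\<^sup>2 + (2 * a - 1 + 2 * M - b) * X - M * (a - 1)) - n' * (M - b - n')) * V"
    unfolding L1_def L2_def diff_op_def eigval_def Vp_def[symmetric] Vm_def[symmetric]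
    by (simp add: X_def[symmetric] a_def[symmetric] b_def[symmetric] M_def[symmetric]
        n'_def[symmetric]) (simp add: X algebra_simps power2_eq_square)
  also have "\<dots> = - Y * \<kappa> * (- (X - M) * (Y - 1 + n') * (F (X + 1) - F X)
      + X * (b + n' - M - Y) * (F (X - 1) - F X) - n' * (- b - n') * F X)"
    unfolding U_plus[folded V_def, folded Vp_def] U_minus[unfolded P_up, folded V_def, folded Vm_def]
      U[folded V_def] F_def[symmetric]
    by (simp add: Y algebra_simps power2_eq_square)
  also have "\<dots> = 0" using hahn by simp
  finally show ?thesis by (simp add: V_def)
qed

theorem mainTheorem7:
  fixes N :: nat and \<alpha> \<beta> :: complex
  assumes "N \<ge> 1"
    and "\<forall>j\<in>{0..N - 1}. \<alpha> \<noteq> - of_nat j"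
    and "\<forall>j\<in>{1..N}. \<beta> \<noteq> - of_nat j"
  shows "(\<forall>n\<in>{0..N}. L1 N \<alpha> \<beta> (U N \<alpha> \<beta> n) = rC (eigval N \<beta> n) * L2 \<alpha> (U N \<alpha> \<beta> n))
    \<and> is_heun_hahn N (L1 N \<alpha> \<beta>)
    \<and> is_heun_hahn N (L2 \<alpha>)
    \<and> L2 \<alpha> = heun_hahn_op N 0 0 0 0 (- 1) 0 (- \<alpha>)"
proof (intro conjI ballI)
  fix n assume n: "n \<in> {0..N}"
  \<comment> \<open>Up to the sign (-1)^n this is (\<alpha>)_n with its factors in reverse order,
    hence the index n - 1 - k below.\<close>
  have "pochhammer (1 - \<alpha> - of_nat n) n \<noteq> 0"
  proof
    assume "pochhammer (1 - \<alpha> - of_nat n) n = 0"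
    then obtain k where k: "k < n" "1 - \<alpha> - of_nat n = - of_nat k"
      by (auto simp: pochhammer_eq_0_iff)
    then have "\<alpha> = - of_nat (n - 1 - k)"
      by (simp add: algebra_simps of_nat_diff)
    moreover have "n - 1 - k \<in> {0..N - 1}" using n by auto
    ultimately show False using assms(2) by blast
  qed
  with n show "L1 N \<alpha> \<beta> (U N \<alpha> \<beta> n) = rC (eigval N \<beta> n) * L2 \<alpha> (U N \<alpha> \<beta> n)"
    by (intro L1_U_eq_eigval_L2_U) auto
next
  show "is_heun_hahn N (L1 N \<alpha> \<beta>)"
    unfolding is_heun_hahn_def using L1_eq_heun_hahn_op by blast
  show "is_heun_hahn N (L2 \<alpha>)"
    unfolding is_heun_hahn_def using L2_eq_heun_hahn_op by blast
qed (rule L2_eq_heun_hahn_op)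

end
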